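(* Let $\eta=2^{-20}$, let $\mathcal{L}_{0,\eta}$ be the Ulam approximation with mesh size $\eta$ of the transfer operator $\mathcal{L}_0$ of the doubling map $T_0(x)=2x \bmod 1$ on $[0,1]$, let $f_\eta=\pi_\eta\hat{\mathcal{L}}h_0$, where $\hat{\mathcal{L}}h_0(x)=-\tfrac14-\tfrac14\ln x$, and let $$\hat h_{appr}=\sum_{i=0}^{19}\mathcal{L}_{0,\eta}^{i}f_\eta ,\qquad \hat h=(\mathrm{Id}-\mathcal{L}_0)^{-1}\hat{\mathcal{L}}h_0 .$$ Then $$\|\hat h_{appr}-\hat h\|_{L^1}\le 0.00021 .$$
   Context: $\mathcal{L}_0$ is the operator on $L^1([0,1])$ given by $\mathcal{L}_0f(x)=\frac{f(x/2)+f(x/2+1/2)}{2}$, with invariant density $h_0\equiv1$. The function $\hat{\mathcal{L}}h_0(x)=-\frac14-\frac14\ln x$ on $(0,1]$ has zero average, and $\hat h=(\mathrm{Id}-\mathcal{L}_0)^{-1}\hat{\mathcal{L}}h_0$ means $\hat h=\sum_{i=0}^\infty\mathcal{L}_0^i\hat{\mathcal{L}}h_0$ (convergent in $L^1$); it is the linear response at $\alpha=0$ of the intermittent family $T_\alpha(x)=x(1+2^\alpha x^\alpha)$ for $0\le x\le 1/2$, $T_\alpha(x)=2x-1$ for $1/2<x\le1$. For $\eta=1/n$, let $\{I_i\}_{i=0}^{n-1}$ be the uniform partition of $[0,1]$ into intervals of length $\eta$, $m$ Lebesgue measure, and $\pi_\eta f=\sum_{i=0}^{n-1}\frac{\int_{I_i}f\,dm}{m(I_i)}\chi_{I_i}$,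 where $\chi_{I_i}$ is the characteristic function of $I_i$. The Ulam approximation of $\mathcal{L}_0$ of mesh size $\eta$ is $\mathcal{L}_{0,\eta}:=\pi_\eta\mathcal{L}_0\pi_\eta$. *)

theory Defs
  imports "HOL-Analysis.Analysis"
begin

text \<open>
  Elements of \<open>L\<^sup>1([0,1])\<close> are represented by functions \<open>real \<Rightarrow> real\<close> that are integrable for
  Lebesgue measure on \<open>[0,1]\<close>; only their values on \<open>[0,1]\<close> matter, and only up to null sets.
\<close>

abbreviation leb01 :: "real measure" where
  "leb01 \<equiv> lebesgue_on {0..1}"

definition L1_norm :: "(real \<Rightarrow> real) \<Rightarrow> real" where
  "L1_norm f = (LINT x|leb01. \<bar>f x\<bar>)"

text \<open>
  The integrability conditions are part of the definition because the Bochner integral of a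
  non-integrable function is \<open>0\<close>.
\<close>

definition L1_sums :: "(nat \<Rightarrow> real \<Rightarrow> real) \<Rightarrow> (real \<Rightarrow> real) \<Rightarrow> bool" where
  "L1_sums F s \<longleftrightarrow>
     (\<forall>i. integrable leb01 (F i)) \<and> integrable leb01 s \<and>
     (\<lambda>N. L1_norm (\<lambda>x. (\<Sum>i<N. F i x) - s x)) \<longlonglongrightarrow> 0"

definition doubling_transfer :: "(real \<Rightarrow> real) \<Rightarrow> real \<Rightarrow> real" where
  "doubling_transfer f x = (f (x / 2) + f (x / 2 + 1 / 2)) / 2"

text \<open>
  The intervals are half-open except for the last one, which contains \<open>1\<close>, so that they form a
  partition of \<open>[0,1]\<close>.
\<close>

definition ulam_interval :: "nat \<Rightarrow> nat \<Rightarrow> real set" where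
  "ulam_interval n i =
     (if Suc i = n then {real i / real n..1} else {real i / real n..<real (Suc i) / real n})"

text \<open>The mesh size \<open>\<eta> = 1 / n\<close> is given through \<open>n\<close>.\<close>

definition ulam_proj :: "nat \<Rightarrow> (real \<Rightarrow> real) \<Rightarrow> real \<Rightarrow> real" where
  "ulam_proj n f x =
     (\<Sum>i<n. (LINT y:ulam_interval n i|lebesgue. f y) / measure lebesgue (ulam_interval n i)
              * indicator (ulam_interval n i) x)"

definition ulam_transfer :: "nat \<Rightarrow> (real \<Rightarrow> real) \<Rightarrow> real \<Rightarrow> real" where
  "ulam_transfer n f = ulam_proj n (doubling_transfer (ulam_proj n f))"

text \<open>
  \<open>\<L>h\<^sub>0\<close> with a hat, for the invariant density \<open>h\<^sub>0 = 1\<close>. Its value at \<open>0\<close>, where \<open>ln 0 = 0\<close> in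
  HOL, plays no role.
\<close>

definition response_source :: "real \<Rightarrow> real" where
  "response_source x = - 1 / 4 - 1 / 4 * ln x"

definition h_appr :: "real \<Rightarrow> real" where
  "h_appr x = (\<Sum>i = 0..19. (ulam_transfer (2 ^ 20) ^^ i) (ulam_proj (2 ^ 20) response_source) x)"

text \<open>
  \<open>h\<close> represents \<open>(Id - \<L>\<^sub>0)\<^sup>-\<^sup>1\<close> applied to \<open>response_source\<close>; it is the \<open>L\<^sup>1\<close>-sum of the
  Neumann series. It is a predicate since \<open>h\<close> is determined only up to null sets.
\<close>

definition is_linear_response :: "(real \<Rightarrow> real) \<Rightarrow> bool" where
  "is_linear_response h \<longleftrightarrow> L1_sums (\<lambda>i. (doubling_transfer ^^ i) response_source) h"

end

theory Submission
  imports Defs "HOL-Real_Asymp.Real_Asymp"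
begin

text \<open>
  Write \<open>L\<close> for the transfer operator, \<open>g\<close> for the source, and \<open>\<pi>\<^sub>m\<close> for the projection onto
  functions that are constant on the dyadic cells of length \<open>1 / 2 ^ m\<close>. The operators \<open>L\<close> and
  \<open>\<pi>\<^sub>m\<close> are positive and preserve integrals, hence are contractions of \<open>L\<^sup>1\<close>.

  The doubling map is compatible with dyadic partitions: \<open>L\<close> maps step functions of level
  \<open>m + 1\<close> to step functions of level \<open>m\<close> (\<open>dyadic_step_doubling_transfer\<close>). Two things follow.
  On step functions of level \<open>20\<close> the Ulam operator with mesh \<open>1 / 2 ^ 20\<close> is \<open>L\<close> itself, so
  that the approximation is the partial sum \<open>\<Sum>i<20. L\<^sup>i (\<pi> g)\<close> with \<open>\<pi> = \<pi>\<^sub>m\<close> for \<open>m = 20\<close>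
  (\<open>funpow_ulam_transfer\<close>). Moreover the \<open>m\<close>-th iterate of \<open>\<pi>\<^sub>m g\<close> is a constant, hence zero
  because \<open>g\<close> has zero average, so the norm of the \<open>m\<close>-th iterate of \<open>g\<close> is at most the
  projection error \<open>e m\<close>, the norm of \<open>g - \<pi>\<^sub>m g\<close> (\<open>L1_norm_funpow_doubling_transfer_le\<close>).

  Everything is thus controlled by the projection errors: the Neumann series converges if they
  are summable, and the error of the approximation is at most \<open>20 * e 20 + (\<Sum>i\<ge>20. e i)\<close>,
  where the first summand comes from replacing \<open>g\<close> by its projection in twenty terms and the
  second one from truncating the series.

  The singularity of \<open>g\<close> at \<open>0\<close> is logarithmic, so \<open>e m\<close> is of order \<open>m / 2 ^ m\<close>. The explicit
  bound \<open>(1 + 7 / 20 * m) / 2 ^ m\<close> (\<open>response_source_proj_error\<close>) follows by comparing \<open>g\<close>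
  with its translate by the mesh size. It gives \<open>20 * 8 / 2 ^ 20 + 16.7 / 2 ^ 20\<close>, below
  \<open>0.00017\<close>.
\<close>

section \<open>Norms and series in \<open>L\<^sup>1([0,1])\<close>\<close>

lemma AE_lebesgue_not_in_finite:
  assumes "finite (A :: real set)"
  shows "AE x in lebesgue. x \<notin> A"
  using assms by (intro AE_not_in) (simp add: null_sets_completionI finite_imp_null_set_lborel)

text \<open>
  The endpoints are excluded because \<open>ln\<close> is singular at \<open>0\<close> and because \<open>1\<close> is sent by the
  inverse branch \<open>x \<mapsto> x / 2\<close> to \<open>1 / 2\<close>, the left endpoint of the next dyadic cell rather than
  a point of the last cell of the left half.
\<close>

lemma AE_leb01I:
  assumes "\<And>x. 0 < x \<Longrightarrow> x < 1 \<Longrightarrow> P x"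
  shows "AE x in leb01. P x"
proof -
  have "AE x in lebesgue. x \<notin> {0, 1::real}"
    by (rule AE_lebesgue_not_in_finite) simp
  then have "AE x in lebesgue. x \<in> {0..1} \<longrightarrow> P x"
    by eventually_elim (use assms in force)
  then show ?thesis
    by (simp add: AE_restrict_space_iff)
qed

lemma L1_norm_nonneg: "0 \<le> L1_norm f"
  by (simp add: L1_norm_def)

lemma L1_norm_le_integral:
  assumes "integrable leb01 g" and "\<And>x. 0 < x \<Longrightarrow> x < 1 \<Longrightarrow> \<bar>f x\<bar> \<le> g x"
  shows "L1_norm f \<le> (LINT x|leb01. g x)"
  unfolding L1_norm_def
  by (rule integral_mono_AE') (use assms in \<open>force intro!: AE_leb01I\<close>)+

lemma L1_norm_triangle:
  assumes "integrable leb01 f" "integrable leb01 g"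
    and "\<And>x. 0 < x \<Longrightarrow> x < 1 \<Longrightarrow> h x = f x + g x"
  shows "L1_norm h \<le> L1_norm f + L1_norm g"
proof -
  have "L1_norm h \<le> (LINT x|leb01. \<bar>f x\<bar> + \<bar>g x\<bar>)"
    by (rule L1_norm_le_integral) (use assms in auto)
  also have "\<dots> = L1_norm f + L1_norm g"
    unfolding L1_norm_def using assms by (intro Bochner_Integration.integral_add) auto
  finally show ?thesis .
qed

lemma L1_norm_sum_le:
  assumes "\<And>i. i \<in> A \<Longrightarrow> integrable leb01 (F i)"
  shows "L1_norm (\<lambda>x. \<Sum>i\<in>A. F i x) \<le> (\<Sum>i\<in>A. L1_norm (F i))"
proof -
  have "L1_norm (\<lambda>x. \<Sum>i\<in>A. F i x) \<le> (LINT x|leb01. (\<Sum>i\<in>A. \<bar>F i x\<bar>))"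
    by (rule L1_norm_le_integral) (use assms in auto)
  also have "\<dots> = (\<Sum>i\<in>A. L1_norm (F i))"
    unfolding L1_norm_def using assms by (intro Bochner_Integration.integral_sum) auto
  finally show ?thesis .
qed

text \<open>
  This is the completeness of \<open>L\<^sup>1\<close> in the form needed for the Neumann series. By monotone
  convergence the series of absolute values has a finite integral, so it converges almost
  everywhere; the pointwise sum is then the \<open>L\<^sup>1\<close> sum by dominated convergence.
\<close>

lemma L1_sums_exists:
  assumes F: "\<And>i. integrable leb01 (F i)" and sum: "summable (\<lambda>i. L1_norm (F i))"
  shows "\<exists>s. L1_sums F s"
proof -
  have [measurable]: "F i \<in> borel_measurable leb01" for i
    using F by auto
  have "(\<integral>\<^sup>+x. (\<Sum>i. ennreal \<bar>F i x\<bar>) \<partial>leb01) = (\<Sum>i. \<integral>\<^sup>+x. ennreal \<bar>F i x\<bar> \<partial>leb01)"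
    by (rule nn_integral_suminf) measurable
  also have "\<dots> = (\<Sum>i. ennreal (L1_norm (F i)))"
    unfolding L1_norm_def using F by (subst nn_integral_eq_integral) auto
  also have "\<dots> \<noteq> \<infinity>"
    using sum by (simp add: L1_norm_nonneg ennreal_suminf_neq_top)
  finally have "AE x in leb01. (\<Sum>i. ennreal \<bar>F i x\<bar>) \<noteq> \<infinity>"
    by (intro nn_integral_PInf_AE) auto
  then have pointwise: "AE x in leb01. summable (\<lambda>i. \<bar>F i x\<bar>)"
    by eventually_elim (auto intro!: summable_suminf_not_top)
  define s where "s x = (\<Sum>i. F i x)" for x
  define w where "w x = (\<Sum>i. \<bar>F i x\<bar>)" for x
  have s: "integrable leb01 s"
    unfolding s_def using F pointwise sum by (intro integrable_suminf) (auto simp: L1_norm_def)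
  have w: "integrable leb01 w"
    unfolding w_def using F pointwise sum by (intro integrable_suminf) (auto simp: L1_norm_def)
  have "(\<lambda>N. LINT x|leb01. \<bar>(\<Sum>i<N. F i x) - s x\<bar>) \<longlonglongrightarrow> (LINT x|leb01. 0)"
  proof (rule integral_dominated_convergence[where w = "\<lambda>x. 2 * w x" and f = "\<lambda>x. 0"
        and s = "\<lambda>N x. \<bar>(\<Sum>i<N. F i x) - s x\<bar>"])
    show "AE x in leb01. (\<lambda>N. \<bar>(\<Sum>i<N. F i x) - s x\<bar>) \<longlonglongrightarrow> 0"
      using pointwise
    proof eventually_elim
      case (elim x)
      then have "(\<lambda>N. \<Sum>i<N. F i x) \<longlonglongrightarrow> s x"
        unfolding s_def by (rule summable_LIMSEQ[OF summable_rabs_cancel])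
      then show ?case
        by (rule tendsto_rabs_zero[OF LIM_zero])
    qed
    show "AE x in leb01. norm \<bar>(\<Sum>i<N. F i x) - s x\<bar> \<le> 2 * w x" for N
      using pointwise
    proof eventually_elim
      case (elim x)
      have "\<bar>\<Sum>i<N. F i x\<bar> \<le> (\<Sum>i<N. \<bar>F i x\<bar>)"
        by (rule sum_abs)
      also have "\<dots> \<le> w x"
        unfolding w_def using elim by (intro sum_le_suminf) auto
      finally have "\<bar>\<Sum>i<N. F i x\<bar> \<le> w x" .
      moreover have "\<bar>s x\<bar> \<le> w x"
        unfolding s_def w_def using elim by (rule summable_rabs)
      ultimately show ?case by simp
    qed
    show "(\<lambda>x. \<bar>(\<Sum>i<N. F i x) - s x\<bar>) \<in> borel_measurable leb01" for N
      using s F by (intro borel_measurable_integrable integrable_abs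
        Bochner_Integration.integrable_diff
        Bochner_Integration.integrable_sum)
    show "integrable leb01 (\<lambda>x. 2 * w x)"
      using w by simp
    show "(\<lambda>x. 0) \<in> borel_measurable leb01" by simp
  qed
  then have "L1_sums F s"
    using F s by (simp add: L1_sums_def L1_norm_def)
  then show ?thesis by blast
qed

text \<open>
  The tail of the series is bounded through a telescoping majorant, so that no infinite sum of
  norms has to be evaluated. Since \<open>s\<close> is known only as an \<open>L\<^sup>1\<close> limit, the tail is not
  available as a pointwise series and is reached through the finite sums from \<open>n\<close> to \<open>N\<close>.
\<close>

lemma L1_sums_tail_bound:
  assumes "L1_sums F s" and b: "\<And>i. i \<ge> n \<Longrightarrow> L1_norm (F i) \<le> a i - a (Suc i)"
    and a: "\<And>i. 0 \<le> a i"
  shows "L1_norm (\<lambda>x. (\<Sum>i<n. F i x) - s x) \<le> a n"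
proof -
  have F: "integrable leb01 (F i)" and s: "integrable leb01 s" for i
    using assms by (auto simp: L1_sums_def)
  \<comment> \<open>The remainders at \<open>n\<close> and \<open>N \<ge> n\<close> differ by at most \<open>a n\<close>; then \<open>N\<close> tends to infinity.\<close>
  define R where "R N = L1_norm (\<lambda>x. (\<Sum>i<N. F i x) - s x)" for N
  have "R n \<le> R N + a n" if "N \<ge> n" for N
  proof -
    have "R n \<le> R N + L1_norm (\<lambda>x. - (\<Sum>i=n..<N. F i x))"
      unfolding R_def
    proof (rule L1_norm_triangle)
      fix x
      have "(\<Sum>i<N. F i x) = (\<Sum>i<n. F i x) + (\<Sum>i=n..<N. F i x)"
        using that by (simp add: lessThan_atLeast0 sum.atLeastLessThan_concat)
      then show "(\<Sum>i<n. F i x) - s x = (\<Sum>i<N. F i x) - s x + - (\<Sum>i=n..<N. F i x)"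
        by simp
    qed (use F s in auto)
    also have "L1_norm (\<lambda>x. - (\<Sum>i=n..<N. F i x)) \<le> (\<Sum>i=n..<N. L1_norm (F i))"
      using L1_norm_sum_le[of "{n..<N}" F] F by (simp add: L1_norm_def)
    also have "\<dots> \<le> (\<Sum>i=n..<N. a i - a (Suc i))"
      using b by (intro sum_mono) auto
    also have "\<dots> = a n - a N"
      using that sum_Suc_diff'[of n N "\<lambda>i. - a i"] by simp
    also have "\<dots> \<le> a n"
      using a by simp
    finally show ?thesis by simp
  qed
  moreover have "R \<longlonglongrightarrow> 0"
    using assms(1) unfolding L1_sums_def R_def[abs_def] by blast
  then have "(\<lambda>N. R N + a n) \<longlonglongrightarrow> 0 + a n"
    by (intro tendsto_intros)
  ultimately have "R n \<le> 0 + a n"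
    by (intro LIMSEQ_le_const) auto
  then show ?thesis
    by (simp add: R_def)
qed

section \<open>The transfer operator of the doubling map\<close>

text \<open>
  The two inverse branches map \<open>[0,1]\<close> affinely, with slope \<open>1 / 2\<close>, onto the two halves of
  \<open>[0,1]\<close>; the substitution turns the two terms of the operator into the integrals over the
  halves.
\<close>

lemma doubling_transfer_integral:
  assumes f: "integrable leb01 f"
  shows "integrable leb01 (doubling_transfer f)"
    and "(LINT x|leb01. doubling_transfer f x) = (LINT x|leb01. f x)"
proof -
  have branch: "has_bochner_integral leb01 (\<lambda>x. f (x / 2 + t))
      (2 * (LINT x|lebesgue_on {t..t + 1 / 2}. f x))" if t: "0 \<le> t" "t \<le> 1 / 2" for t
  proof -
    have "integrable (lebesgue_on {t..t + 1 / 2}) f"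
      using integrable_subinterval[OF f] t by auto
    then have "has_bochner_integral lebesgue (\<lambda>x. indicator {t..t + 1 / 2} x *\<^sub>R f x)
        (LINT x|lebesgue_on {t..t + 1 / 2}. f x)"
      by (simp add: has_bochner_integral_iff integrable_restrict_space integral_restrict_space)
    then have "has_bochner_integral lebesgue
        (\<lambda>x. indicator {t..t + 1 / 2} (t + 1 / 2 * x) *\<^sub>R f (t + 1 / 2 * x))
        ((LINT x|lebesgue_on {t..t + 1 / 2}. f x) /\<^sub>R \<bar>1 / 2\<bar>)"
      by (subst has_bochner_integral_lebesgue_real_affine_iff[symmetric]) auto
    also have "(\<lambda>x. indicator {t..t + 1 / 2} (t + 1 / 2 * x) *\<^sub>R f (t + 1 / 2 * x))
        = (\<lambda>x. indicator {0..1} x *\<^sub>R f (x / 2 + t))"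
      by (auto simp: indicator_def fun_eq_iff add.commute)
    finally show ?thesis
      by (simp add: has_bochner_integral_restrict_space field_simps)
  qed
  have "has_bochner_integral leb01 (doubling_transfer f)
     ((2 * (LINT x|lebesgue_on {0..1 / 2}. f x) + 2 * (LINT x|lebesgue_on {1 / 2..1}. f x)) / 2)"
    unfolding doubling_transfer_def
    using branch[of 0] branch[of "1/2"]
    by (intro has_bochner_integral_divide_zero has_bochner_integral_add) auto
  also have "(2 * (LINT x|lebesgue_on {0..1 / 2}. f x) + 2 * (LINT x|lebesgue_on {1 / 2..1}. f x)) / 2
      = (LINT x|leb01. f x)"
    using Equivalence_Measurable_On_Borel.integral_combine[OF f, of "1/2"] by simp
  finally show "integrable leb01 (doubling_transfer f)"
    and "(LINT x|leb01. doubling_transfer f x) = (LINT x|leb01. f x)"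
    by (auto simp: has_bochner_integral_iff)
qed

text \<open>
  A positive operator that preserves integrals is an \<open>L\<^sup>1\<close> contraction: compare the image of
  \<open>f\<close> with the image of \<open>\<bar>f\<bar>\<close>. The same argument works for the projection in
  \<open>L1_norm_ulam_proj\<close>.
\<close>

lemma L1_norm_doubling_transfer:
  assumes "integrable leb01 f"
  shows "L1_norm (doubling_transfer f) \<le> L1_norm f"
proof -
  have "L1_norm (doubling_transfer f) \<le> (LINT x|leb01. doubling_transfer (\<lambda>x. \<bar>f x\<bar>) x)"
    using assms
    by (intro L1_norm_le_integral doubling_transfer_integral) (auto simp: doubling_transfer_def)
  also have "\<dots> = L1_norm f"
    using assms by (subst doubling_transfer_integral) (auto simp: L1_norm_def)
  finally show ?thesis .
qed

lemma funpow_doubling_transfer: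
  assumes f: "integrable leb01 f"
  shows "integrable leb01 ((doubling_transfer ^^ i) f)"
    and "(LINT x|leb01. (doubling_transfer ^^ i) f x) = (LINT x|leb01. f x)"
    and "L1_norm ((doubling_transfer ^^ i) f) \<le> L1_norm f"
proof (induction i)
  case 0
  case 1 show ?case using f by simp
  case 2 show ?case by simp
  case 3 show ?case by simp
next
  case (Suc i)
  case 1 show ?case using doubling_transfer_integral(1)[OF Suc(1)] by simp
  case 2 show ?case using doubling_transfer_integral(2)[OF Suc(1)] Suc(2) by simp
  case 3 show ?case using L1_norm_doubling_transfer[OF Suc(1)] Suc(3) by simp
qed

lemma funpow_doubling_transfer_diff:
  "(doubling_transfer ^^ i) (\<lambda>x. f x - g x)
    = (\<lambda>x. (doubling_transfer ^^ i) f x - (doubling_transfer ^^ i) g x)"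
proof (induction i)
  case (Suc i)
  have "doubling_transfer (\<lambda>x. u x - v x)
      = (\<lambda>x. doubling_transfer u x - doubling_transfer v x)" for u v
    by (simp add: doubling_transfer_def fun_eq_iff diff_divide_distrib add_divide_distrib)
  with Suc show ?case by simp
qed simp

text \<open>
  Both inverse branches map \<open>{0..<1}\<close> into itself. Identities between iterates can therefore
  be proved pointwise on \<open>{0..<1}\<close>, which avoids carrying null sets through the iteration.
\<close>

lemma doubling_transfer_cong:
  assumes "\<And>x. x \<in> {0..<1} \<Longrightarrow> f x = g x" "x \<in> {0..<1}"
  shows "doubling_transfer f x = doubling_transfer g x"
  using assms by (simp add: doubling_transfer_def)

section \<open>Conditional expectation on a uniform partition\<close>

lemma ulam_interval_iff_floor:
  assumes "x \<in> {0..<1}" "i < n"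
  shows "x \<in> ulam_interval n i \<longleftrightarrow> \<lfloor>real n * x\<rfloor> = int i"
proof -
  have "x \<in> ulam_interval n i \<longleftrightarrow> real i / real n \<le> x \<and> x < real (Suc i) / real n"
    using assms by (auto simp: ulam_interval_def)
  also have "\<dots> \<longleftrightarrow> real i \<le> real n * x \<and> real n * x < real i + 1"
    using assms by (simp add: field_simps)
  also have "\<dots> \<longleftrightarrow> \<lfloor>real n * x\<rfloor> = int i"
    by (simp add: floor_eq_iff)
  finally show ?thesis .
qed

lemma floor_index:
  assumes "x \<in> {0..<1}" "n > 0"
  shows "nat \<lfloor>real n * x\<rfloor> < n" "\<lfloor>real n * x\<rfloor> = int (nat \<lfloor>real n * x\<rfloor>)"
proof -
  have "real n * x < real n"
    using assms by simp
  then have "\<lfloor>real n * x\<rfloor> < int n" "\<lfloor>real n * x\<rfloor> \<ge> 0"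
    using assms by (auto simp: floor_less_iff)
  then show "nat \<lfloor>real n * x\<rfloor> < n" "\<lfloor>real n * x\<rfloor> = int (nat \<lfloor>real n * x\<rfloor>)"
    by linarith+
qed

lemma ulam_interval_subset:
  assumes "i < n"
  shows "ulam_interval n i \<subseteq> {0..1}"
proof
  fix x assume "x \<in> ulam_interval n i"
  then have "real i / real n \<le> x" "x \<le> max 1 (real (Suc i) / real n)"
    by (auto simp: ulam_interval_def split: if_splits)
  moreover have "0 \<le> real i / real n" "real (Suc i) / real n \<le> 1"
    using assms by auto
  ultimately have "0 \<le> x" "x \<le> 1"
    by linarith+
  then show "x \<in> {0..1}"
    by simp
qed

lemma ulam_interval_sets [measurable]: "ulam_interval n i \<in> sets lebesgue"
  by (simp add: ulam_interval_def)

lemma measure_ulam_interval: "i < n \<Longrightarrow> measure lebesgue (ulam_interval n i) = 1 / real n"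
  by (auto simp: ulam_interval_def field_simps)

lemma emeasure_ulam_interval_finite: "emeasure lebesgue (ulam_interval n i) < \<infinity>"
  using emeasure_bounded_finite[of "{real i / real n..<real (Suc i) / real n}"]
  by (auto simp: ulam_interval_def)

lemma ulam_proj_floor:
  assumes x: "x \<in> {0..<1}" and n: "n > 0"
  shows "ulam_proj n f x
    = real n * (LINT y:ulam_interval n (nat \<lfloor>real n * x\<rfloor>)|lebesgue. f y)"
proof -
  let ?k = "nat \<lfloor>real n * x\<rfloor>"
  have "ulam_proj n f x = (\<Sum>i<n. if i = ?k then real n * (LINT y:ulam_interval n i|lebesgue. f y) else 0)"
    unfolding ulam_proj_def
    using floor_index[OF x n] ulam_interval_iff_floor[OF x]
    by (intro sum.cong) (auto simp: measure_ulam_interval)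
  then show ?thesis
    using floor_index[OF x n] by simp
qed

lemma integral_ulam_intervals:
  fixes f :: "real \<Rightarrow> real"
  assumes f: "integrable leb01 f" and n: "n > 0"
  shows "(\<Sum>i<n. LINT y:ulam_interval n i|lebesgue. f y) = (LINT x|leb01. f x)"
proof -
  have int: "set_integrable lebesgue {0..1} f"
    using f by (simp add: set_integrable_def integrable_restrict_space)
  have "(\<Sum>i<n. LINT y:ulam_interval n i|lebesgue. f y)
      = (LINT y:(\<Union>i<n. ulam_interval n i)|lebesgue. f y)"
  proof (rule set_integral_finite_UN_AE[symmetric])
    fix i j assume ij: "i \<in> {..<n}" "j \<in> {..<n}"
    have "AE x in lebesgue. x \<notin> {1::real}"
      by (rule AE_lebesgue_not_in_finite) simp
    then show "AE x in lebesgue. x \<in> ulam_interval n i \<and> x \<in> ulam_interval n j \<longrightarrow> i = j"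
    proof eventually_elim
      case (elim x)
      show ?case
      proof
        assume x: "x \<in> ulam_interval n i \<and> x \<in> ulam_interval n j"
        then have "x \<in> {0..<1}"
          using elim ulam_interval_subset[of i n] ij by force
        then show "i = j"
          using x ulam_interval_iff_floor ij by force
      qed
    qed
  qed (use int ulam_interval_subset set_integrable_subset[OF int ulam_interval_sets] in auto)
  also have "(\<Union>i<n. ulam_interval n i) = {0..1}"
  proof
    show "{0..1} \<subseteq> (\<Union>i<n. ulam_interval n i)"
    proof
      fix x :: real assume x: "x \<in> {0..1}"
      show "x \<in> (\<Union>i<n. ulam_interval n i)"
      proof (cases "x = 1")
        case True
        then have "x \<in> ulam_interval n (n - 1)"
          using n by (simp add: ulam_interval_def)
        with n show ?thesis
          by (intro UN_I[of "n - 1"]) auto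
      next
        case False
        then have "x \<in> {0..<1}"
          using x by simp
        then show ?thesis
          using floor_index[of x n] ulam_interval_iff_floor n by blast
      qed
    qed
  qed (use ulam_interval_subset in blast)
  finally show ?thesis
    by (simp add: set_lebesgue_integral_def integral_restrict_space)
qed

lemma ulam_proj_integral:
  assumes n: "n > 0"
  shows "integrable leb01 (ulam_proj n f)"
    and "integrable leb01 f \<Longrightarrow> (LINT x|leb01. ulam_proj n f x) = (LINT x|leb01. f x)"
proof -
  define c where "c i = (LINT y:ulam_interval n i|lebesgue. f y)" for i
  have indicator: "has_bochner_integral leb01 (\<lambda>x. c i / measure lebesgue (ulam_interval n i)
        * indicator (ulam_interval n i) x) (c i)" if "i < n" for i
  proof -
    have "has_bochner_integral lebesgue (indicator (ulam_interval n i)) (1 / real n)"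
      using has_bochner_integral_real_indicator[OF ulam_interval_sets, of n i]
        measure_ulam_interval[OF that] emeasure_ulam_interval_finite[of n i] by simp
    then have "has_bochner_integral leb01 (indicator (ulam_interval n i)) (1 / real n)"
      using ulam_interval_subset[OF that]
      by (subst has_bochner_integral_restrict_space)
        (auto simp: indicator_inter_arith[symmetric] Int_absorb1)
    from has_bochner_integral_mult_right[OF this, of "c i / measure lebesgue (ulam_interval n i)"]
    show ?thesis
      using n measure_ulam_interval[OF that] by simp
  qed
  have "has_bochner_integral leb01 (ulam_proj n f) (\<Sum>i<n. c i)"
    unfolding ulam_proj_def c_def[symmetric]
    using indicator by (intro has_bochner_integral_sum) auto
  moreover have "(\<Sum>i<n. c i) = (LINT x|leb01. f x)" if "integrable leb01 f"
    unfolding c_def using integral_ulam_intervals[OF that n] .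
  ultimately show "integrable leb01 (ulam_proj n f)"
    and "integrable leb01 f \<Longrightarrow> (LINT x|leb01. ulam_proj n f x) = (LINT x|leb01. f x)"
    by (auto simp: has_bochner_integral_iff)
qed

lemma set_integrable_ulam_interval:
  fixes f :: "real \<Rightarrow> real"
  assumes "integrable leb01 f" "i < n"
  shows "set_integrable lebesgue (ulam_interval n i) f"
proof -
  have "set_integrable lebesgue {0..1} f"
    using assms(1) by (simp add: set_integrable_def integrable_restrict_space)
  then show ?thesis
    by (rule set_integrable_subset[OF _ ulam_interval_sets ulam_interval_subset[OF assms(2)]])
qed

lemma ulam_proj_diff:
  assumes "integrable leb01 f" "integrable leb01 g" "x \<in> {0..<1}" "n > 0"
  shows "ulam_proj n (\<lambda>x. f x - g x) x = ulam_proj n f x - ulam_proj n g x"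
  using assms floor_index[of x n]
  by (simp add: ulam_proj_floor set_integral_diff set_integrable_ulam_interval right_diff_distrib)

lemma L1_norm_ulam_proj:
  assumes f: "integrable leb01 f" and n: "n > 0"
  shows "L1_norm (ulam_proj n f) \<le> L1_norm f"
proof -
  have "L1_norm (ulam_proj n f) \<le> (LINT x|leb01. ulam_proj n (\<lambda>x. \<bar>f x\<bar>) x)"
  proof (rule L1_norm_le_integral)
    fix x :: real assume "0 < x" "x < 1"
    then have x: "x \<in> {0..<1}" by simp
    show "\<bar>ulam_proj n f x\<bar> \<le> ulam_proj n (\<lambda>x. \<bar>f x\<bar>) x"
      using set_integral_norm_bound[OF set_integrable_ulam_interval[OF f floor_index(1)[OF x n]]]
      by (simp add: ulam_proj_floor[OF x n] abs_mult n)
  qed (rule ulam_proj_integral[OF n])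
  also have "\<dots> = L1_norm f"
    using f ulam_proj_integral(2)[OF n, of "\<lambda>x. \<bar>f x\<bar>"] by (simp add: L1_norm_def)
  finally show ?thesis .
qed

section \<open>Dyadic step functions\<close>

text \<open>
  Only points of \<open>{0..<1}\<close> are constrained: constancy on a last cell containing \<open>1\<close> would not
  be preserved by the transfer operator, whose value at \<open>1\<close> involves the value of \<open>f\<close> at
  \<open>1 / 2\<close>.
\<close>

definition dyadic_step :: "nat \<Rightarrow> (real \<Rightarrow> real) \<Rightarrow> bool" where
  "dyadic_step m f \<longleftrightarrow>
    (\<forall>x\<in>{0..<1}. \<forall>y\<in>{0..<1}. \<lfloor>2 ^ m * x\<rfloor> = \<lfloor>2 ^ m * y\<rfloor> \<longrightarrow> f x = f y)"

lemma dyadic_step_ulam_proj: "dyadic_step m (ulam_proj (2 ^ m) f)"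
  unfolding dyadic_step_def using ulam_proj_floor[of _ "2 ^ m" f] by simp

text \<open>
  The average over a cell is the value that \<open>f\<close> takes there. For the last cell, which contains
  \<open>1\<close>, this is true because \<open>f\<close> can deviate from that value only on the null set \<open>{1}\<close>.
\<close>

lemma ulam_proj_dyadic_step:
  assumes step: "dyadic_step m f" and f: "integrable leb01 f" and x: "x \<in> {0..<1}"
  shows "ulam_proj (2 ^ m) f x = f x"
proof -
  define n :: nat where "n = 2 ^ m"
  define k where "k = nat \<lfloor>real n * x\<rfloor>"
  have n: "n > 0" by (simp add: n_def)
  have k: "k < n" "\<lfloor>real n * x\<rfloor> = int k"
    using floor_index[OF x n] by (auto simp: k_def)
  have "(LINT y:ulam_interval n k|lebesgue. f y) = (LINT y:ulam_interval n k|lebesgue. f x)"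
    unfolding set_lebesgue_integral_def
  proof (rule integral_cong_AE)
    have "AE y in lebesgue. y \<notin> {1::real}"
      by (rule AE_lebesgue_not_in_finite) simp
    then show "AE y in lebesgue. indicator (ulam_interval n k) y *\<^sub>R f y
        = indicator (ulam_interval n k) y *\<^sub>R f x"
    proof eventually_elim
      case (elim y)
      show ?case
      proof (cases "y \<in> ulam_interval n k")
        case True
        then have y: "y \<in> {0..<1}"
          using elim ulam_interval_subset[OF k(1)] by force
        then have "\<lfloor>real n * y\<rfloor> = \<lfloor>real n * x\<rfloor>"
          using True k ulam_interval_iff_floor by simp
        then have "\<lfloor>2 ^ m * y\<rfloor> = \<lfloor>2 ^ m * x\<rfloor>"
          by (simp add: n_def)
        then have "f y = f x"
          using step x y unfolding dyadic_step_def by blast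
        then show ?thesis by simp
      qed simp
    qed
    show "(\<lambda>y. indicator (ulam_interval n k) y *\<^sub>R f y) \<in> borel_measurable lebesgue"
      using set_integrable_ulam_interval[OF f k(1)] unfolding set_integrable_def by simp
    show "(\<lambda>y. indicator (ulam_interval n k) y *\<^sub>R f x) \<in> borel_measurable lebesgue"
      by (rule borel_measurable_scaleR[OF borel_measurable_indicator[OF ulam_interval_sets]
        borel_measurable_const])
  qed
  also have "\<dots> = f x / real n"
    using measure_ulam_interval[OF k(1)] emeasure_ulam_interval_finite[of n k]
    by (simp add: set_integral_const)
  finally show ?thesis
    using n by (simp add: ulam_proj_floor[OF x n] k_def[symmetric] flip: n_def)
qed

text \<open>
  Doubling maps a dyadic cell of length \<open>1 / 2 ^ Suc m\<close> onto one of length \<open>1 / 2 ^ m\<close>, so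
  each application of the transfer operator makes a step function coarser by one level. This
  is why dyadic Ulam approximations of the doubling map are exact on step functions.
\<close>

lemma dyadic_step_doubling_transfer:
  assumes "dyadic_step (Suc m) f"
  shows "dyadic_step m (doubling_transfer f)"
  unfolding dyadic_step_def
proof (intro ballI impI)
  fix x y :: real
  assume xy: "x \<in> {0..<1}" "y \<in> {0..<1}" and eq: "\<lfloor>2 ^ m * x\<rfloor> = \<lfloor>2 ^ m * y\<rfloor>"
  have f: "f u = f v" if "u \<in> {0..<1}" "v \<in> {0..<1}" "\<lfloor>2 ^ Suc m * u\<rfloor> = \<lfloor>2 ^ Suc m * v\<rfloor>" for u v
    using assms that unfolding dyadic_step_def by blast
  have "2 ^ Suc m * (z / 2 + 1 / 2) = 2 ^ m * z + of_int (2 ^ m)" for z :: real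
    by (simp add: field_simps)
  then have "\<lfloor>2 ^ Suc m * (x / 2 + 1 / 2)\<rfloor> = \<lfloor>2 ^ Suc m * (y / 2 + 1 / 2)\<rfloor>"
    using eq by (simp only: floor_add_int[symmetric])
  then have "f (x / 2 + 1 / 2) = f (y / 2 + 1 / 2)"
    using xy by (intro f) auto
  moreover have "f (x / 2) = f (y / 2)"
    using xy eq by (intro f) auto
  ultimately show "doubling_transfer f x = doubling_transfer f y"
    by (simp add: doubling_transfer_def)
qed

lemma dyadic_step_Suc:
  assumes "dyadic_step m f"
  shows "dyadic_step (Suc m) f"
  unfolding dyadic_step_def
proof (intro ballI impI)
  fix x y :: real
  assume xy: "x \<in> {0..<1}" "y \<in> {0..<1}" and eq: "\<lfloor>2 ^ Suc m * x\<rfloor> = \<lfloor>2 ^ Suc m * y\<rfloor>"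
  have "\<lfloor>2 ^ m * z\<rfloor> = \<lfloor>2 ^ Suc m * z\<rfloor> div 2" for z :: real
    using floor_divide_real_eq_div[of 2 "2 ^ Suc m * z"] by simp
  then have "\<lfloor>2 ^ m * x\<rfloor> = \<lfloor>2 ^ m * y\<rfloor>"
    using eq by simp
  then show "f x = f y"
    using assms xy unfolding dyadic_step_def by blast
qed

lemma ulam_transfer_dyadic_step:
  assumes step: "dyadic_step m f" and f: "integrable leb01 f" and x: "x \<in> {0..<1}"
  shows "ulam_transfer (2 ^ m) f x = doubling_transfer f x"
proof -
  define g where "g = doubling_transfer (ulam_proj (2 ^ m) f)"
  have "dyadic_step m g"
    unfolding g_def
    by (intro dyadic_step_doubling_transfer dyadic_step_Suc dyadic_step_ulam_proj)
  moreover have "integrable leb01 g"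
    unfolding g_def by (intro doubling_transfer_integral ulam_proj_integral) auto
  ultimately have "ulam_transfer (2 ^ m) f x = g x"
    unfolding ulam_transfer_def g_def[symmetric] using x by (rule ulam_proj_dyadic_step)
  also have "\<dots> = doubling_transfer f x"
    unfolding g_def using ulam_proj_dyadic_step[OF step f] x by (rule doubling_transfer_cong)
  finally show ?thesis .
qed

text \<open>
  After the first projection the discretised dynamics coincides with the exact one, since all
  later functions are already step functions of level \<open>m\<close>. The only discretisation error is
  the one made on the initial function.
\<close>

lemma funpow_ulam_transfer:
  assumes x: "x \<in> {0..<1}"
  shows "(ulam_transfer (2 ^ m) ^^ i) (ulam_proj (2 ^ m) f) x
    = (doubling_transfer ^^ i) (ulam_proj (2 ^ m) f) x"
  using x
proof (induction i arbitrary: x)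
  case (Suc i)
  let ?u = "(ulam_transfer (2 ^ m) ^^ i) (ulam_proj (2 ^ m) f)"
  \<comment> \<open>Every iterate, the initial one included, is the projection of some function.\<close>
  have "\<exists>g. ?u = ulam_proj (2 ^ m) g"
    by (cases i) (auto simp: ulam_transfer_def)
  then have "dyadic_step m ?u" "integrable leb01 ?u"
    using dyadic_step_ulam_proj ulam_proj_integral(1)[of "2 ^ m"] by fastforce+
  then have "ulam_transfer (2 ^ m) ?u x = doubling_transfer ?u x"
    using Suc.prems by (rule ulam_transfer_dyadic_step)
  also have "\<dots> = doubling_transfer ((doubling_transfer ^^ i) (ulam_proj (2 ^ m) f)) x"
    using Suc by (intro doubling_transfer_cong)
  finally show ?case by simp
qed simp

text \<open>
  After \<open>m\<close> steps a step function of level \<open>m\<close> has reached level \<open>0\<close>, so it is constant, and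
  the constant is the preserved integral.
\<close>

lemma funpow_doubling_transfer_ulam_proj:
  assumes f: "integrable leb01 f" and zero: "(LINT x|leb01. f x) = 0" and x: "x \<in> {0..<1}"
  shows "(doubling_transfer ^^ m) (ulam_proj (2 ^ m) f) x = 0"
proof -
  define u where "u = (doubling_transfer ^^ m) (ulam_proj (2 ^ m) f)"
  have "dyadic_step (m - i) ((doubling_transfer ^^ i) (ulam_proj (2 ^ m) f))" if "i \<le> m" for i
    using that
  proof (induction i)
    case (Suc i)
    then have "dyadic_step (Suc (m - Suc i)) ((doubling_transfer ^^ i) (ulam_proj (2 ^ m) f))"
      by (simp add: Suc_diff_Suc)
    then show ?case
      by (simp add: dyadic_step_doubling_transfer)
  qed (simp add: dyadic_step_ulam_proj)
  from this[of m] have "dyadic_step 0 u"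
    by (simp add: u_def)
  then have const: "u y = u x" if "y \<in> {0..<1}" for y
  proof -
    have "\<lfloor>x\<rfloor> = 0" "\<lfloor>y\<rfloor> = 0"
      using x that by (auto intro: floor_unique)
    then have "\<lfloor>2 ^ 0 * y\<rfloor> = \<lfloor>2 ^ 0 * x\<rfloor>"
      by simp
    then show ?thesis
      using \<open>dyadic_step 0 u\<close> x that unfolding dyadic_step_def by blast
  qed
  have u: "integrable leb01 u" "(LINT y|leb01. u y) = 0"
    unfolding u_def using funpow_doubling_transfer(1,2)[OF ulam_proj_integral(1)]
      ulam_proj_integral(2)[OF _ f, of "2 ^ m"] zero by simp_all
  have "(LINT y|leb01. u y) = (LINT y|leb01. u x)"
    using u const by (intro integral_cong_AE AE_leb01I) auto
  then show ?thesis
    using u by (simp add: u_def measure_restrict_space)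
qed

text \<open>
  Decay of correlations for a function of zero average, without any spectral argument: the
  \<open>m\<close>-th iterate of the projected function vanishes, so only the projection error at level \<open>m\<close>
  is left, and iteration does not increase its norm.
\<close>

lemma L1_norm_funpow_doubling_transfer_le:
  assumes f: "integrable leb01 f" and zero: "(LINT x|leb01. f x) = 0"
  shows "L1_norm ((doubling_transfer ^^ m) f) \<le> L1_norm (\<lambda>x. f x - ulam_proj (2 ^ m) f x)"
proof -
  let ?r = "\<lambda>x. f x - ulam_proj (2 ^ m) f x"
  have r: "integrable leb01 ?r"
    using f ulam_proj_integral(1)[of "2 ^ m" f] by simp
  have "L1_norm ((doubling_transfer ^^ m) f) \<le> (LINT x|leb01. \<bar>(doubling_transfer ^^ m) ?r x\<bar>)"
    using funpow_doubling_transfer(1)[OF r] funpow_doubling_transfer_ulam_proj[OF f zero]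
    by (intro L1_norm_le_integral) (auto simp: funpow_doubling_transfer_diff)
  also have "\<dots> \<le> L1_norm ?r"
    using funpow_doubling_transfer(3)[OF r] by (simp add: L1_norm_def)
  finally show ?thesis .
qed

text \<open>
  Up to the factor \<open>2\<close> the projection is the best approximation by step functions, because it
  fixes \<open>s\<close> and is a contraction: \<open>f - \<pi> f = (f - s) - \<pi> (f - s)\<close>. This allows \<open>s\<close> to be
  chosen so that its distance from \<open>f\<close> has a closed form, which the cell averages of \<open>f\<close> do
  not offer.
\<close>

lemma ulam_proj_error_le:
  assumes f: "integrable leb01 f" and s: "dyadic_step m s" "integrable leb01 s"
  shows "L1_norm (\<lambda>x. f x - ulam_proj (2 ^ m) f x) \<le> 2 * L1_norm (\<lambda>x. f x - s x)"
proof -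
  let ?r = "\<lambda>x. f x - s x"
  have r: "integrable leb01 ?r"
    using f s by simp
  have "L1_norm (\<lambda>x. f x - ulam_proj (2 ^ m) f x)
      \<le> L1_norm ?r + L1_norm (\<lambda>x. - ulam_proj (2 ^ m) ?r x)"
  proof (rule L1_norm_triangle)
    fix x :: real assume "0 < x" "x < 1"
    then show "f x - ulam_proj (2 ^ m) f x = ?r x + - ulam_proj (2 ^ m) ?r x"
      using f s by (simp add: ulam_proj_diff ulam_proj_dyadic_step)
  qed (use r ulam_proj_integral(1)[of "2 ^ m" ?r] in auto)
  also have "\<dots> \<le> 2 * L1_norm ?r"
    using L1_norm_ulam_proj[OF r, of "2 ^ m"] by (simp add: L1_norm_def)
  finally show ?thesis .
qed

section \<open>Projection error of the logarithmic source\<close>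

text \<open>
  For \<open>d = 0\<close> the integrand is unbounded at \<open>0\<close>. The antiderivative \<open>(x + d) * ln (x + d) - x\<close>
  is still continuous there, and \<open>ln (x + d)\<close> is bounded above, so it is absolutely
  integrable. The case \<open>d = 0\<close> gives the average of the source; together with the shifted case
  it gives the distance between the source and its translate.
\<close>

lemma ln_shift_integral:
  fixes d :: real
  assumes d: "d \<ge> 0"
  shows "has_bochner_integral leb01 (\<lambda>x. ln (x + d)) ((1 + d) * ln (1 + d) - d * ln d - 1)"
proof -
  have xlnx: "continuous_on {0..} (\<lambda>x::real. x * ln x)"
  proof -
    have "((\<lambda>x::real. x * ln x) \<longlongrightarrow> 0) (at_right 0)"
      by real_asymp
    then have "continuous (at x within {0..}) (\<lambda>x::real. x * ln x)" if "x \<ge> 0" for x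
      using that
      by (cases "x = 0")
        (auto simp: continuous_within at_within_Ici_at_right intro!: tendsto_eq_intros)
    then show ?thesis
      by (simp add: continuous_on_eq_continuous_within)
  qed
  have "continuous_on {0..1} (\<lambda>x. (x + d) * ln (x + d))"
    using d by (intro continuous_on_compose2[OF xlnx]) (auto intro!: continuous_intros)
  then have hk: "((\<lambda>x. ln (x + d)) has_integral
      ((1 + d) * ln (1 + d) - 1) - ((0 + d) * ln (0 + d) - 0)) {0..1}"
  proof (intro fundamental_theorem_of_calculus_interior)
    fix x :: real assume "x \<in> {0<..<1}"
    then have "((\<lambda>x. (x + d) * ln (x + d) - x) has_real_derivative ln (x + d)) (at x)"
      using d by (auto intro!: derivative_eq_intros)
    then show "((\<lambda>x. (x + d) * ln (x + d) - x) has_vector_derivative ln (x + d)) (at x)"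
      by (simp add: has_real_derivative_iff_has_vector_derivative)
  qed (auto intro!: continuous_intros)
  \<comment> \<open>Integrability of a function of constant sign is automatically absolute.\<close>
  have "(\<lambda>x. ln (1 + d) - ln (x + d)) absolutely_integrable_on {0..1}"
  proof (rule nonnegative_absolutely_integrable_1)
    show "(\<lambda>x. ln (1 + d) - ln (x + d)) integrable_on {0..1}"
      using hk by (intro Henstock_Kurzweil_Integration.integrable_diff) auto
    fix x :: real assume "x \<in> {0..1}"
    then show "0 \<le> ln (1 + d) - ln (x + d)"
      using d by (cases "x + d = 0") auto
  qed
  then have "integrable leb01 (\<lambda>x. ln (1 + d) - ln (x + d))"
    by (simp add: set_integrable_def integrable_restrict_space)
  from Bochner_Integration.integrable_diff[OF _ this, of "\<lambda>x. ln (1 + d)"]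
  have int: "integrable leb01 (\<lambda>x. ln (x + d))"
    by simp
  moreover have "(LINT x|leb01. ln (x + d)) = (1 + d) * ln (1 + d) - d * ln d - 1"
    using lebesgue_integral_eq_integral[OF int] integral_unique[OF hk] by simp
  ultimately show ?thesis
    by (simp add: has_bochner_integral_iff)
qed

lemma response_source_integral:
  "integrable leb01 response_source" "(LINT x|leb01. response_source x) = 0"
proof -
  have "has_bochner_integral leb01 (\<lambda>x. 1) (1::real)"
    by (simp add: has_bochner_integral_iff measure_restrict_space)
  with ln_shift_integral[of 0]
  have "has_bochner_integral leb01 (\<lambda>x. - 1 / 4 * 1 - 1 / 4 * ln (x + 0)) (- 1 / 4 * 1 - 1 / 4 * (- 1))"
    by (intro has_bochner_integral_diff has_bochner_integral_mult_right) auto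
  then have "has_bochner_integral leb01 response_source 0"
    by (simp add: response_source_def[abs_def])
  then show "integrable leb01 response_source" "(LINT x|leb01. response_source x) = 0"
    by (auto simp: has_bochner_integral_iff)
qed

lemma response_source_antimono:
  assumes "0 < x" "x \<le> y"
  shows "response_source y \<le> response_source x"
  using assms by (simp add: response_source_def)

text \<open>
  The comparison step function \<open>s\<close> takes on each cell the value of the source at the right
  endpoint. The source is decreasing and the right endpoint lies between \<open>x\<close> and \<open>x + d\<close>,
  where \<open>d\<close> is the mesh size, so \<open>s\<close> lies between the source and its translate by \<open>d\<close>. The
  \<open>L\<^sup>1\<close> distance from the source to its translate is an explicit integral of order
  \<open>d * ln (1 / d)\<close>. The rational coefficient \<open>7 / 20\<close> is half of the upper bound \<open>7 / 10\<close> for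
  \<open>ln 2\<close>.
\<close>

lemma response_source_proj_error:
  "L1_norm (\<lambda>x. response_source x - ulam_proj (2 ^ m) response_source x)
    \<le> (1 + 7 / 20 * real m) / 2 ^ m"
proof -
  define d :: real where "d = 1 / 2 ^ m"
  have d: "0 < d" "d \<le> 1"
    by (auto simp: d_def)
  define s :: "real \<Rightarrow> real" where "s x = response_source ((of_int \<lfloor>2 ^ m * x\<rfloor> + 1) * d)" for x
  have step: "dyadic_step m s"
    by (auto simp: dyadic_step_def s_def)
  let ?w = "\<lambda>x. 1 / 4 * (ln (x + d) - ln (x + 0))"
  have w: "has_bochner_integral leb01 ?w (1 / 4 * (((1 + d) * ln (1 + d) - d * ln d - 1) - (- 1)))"
    using ln_shift_integral[of d] ln_shift_integral[of 0] d
    by (intro has_bochner_integral_mult_right has_bochner_integral_diff) auto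
  \<comment> \<open>The translate is compared for \<open>x > 0\<close> only: at \<open>0\<close> the value \<open>ln 0 = 0\<close> breaks monotonicity.\<close>
  have bound: "\<bar>response_source x - s x\<bar> \<le> ?w x" if "0 < x" for x
  proof -
    let ?y = "(of_int \<lfloor>2 ^ m * x\<rfloor> + 1) * d"
    have "x = (2 ^ m * x) * d" "x + d = (2 ^ m * x + 1) * d"
      by (auto simp: d_def field_simps)
    moreover have "2 ^ m * x \<le> of_int \<lfloor>2 ^ m * x\<rfloor> + 1" "of_int \<lfloor>2 ^ m * x\<rfloor> \<le> 2 ^ m * x"
      by linarith+
    ultimately have "x \<le> ?y" "?y \<le> x + d"
      using d by (metis mult_right_mono less_imp_le add_right_mono)+
    then have "s x \<le> response_source x" "response_source (x + d) \<le> s x"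
      unfolding s_def using that by (auto intro!: response_source_antimono)
    then show ?thesis
      by (simp add: response_source_def)
  qed
  have "s \<in> borel_measurable borel"
    unfolding s_def response_source_def by measurable
  then have [measurable]: "s \<in> borel_measurable leb01"
    by (simp add: measurable_completion measurable_restrict_space1)
  have "integrable leb01 (\<lambda>x. response_source x - s x)"
  proof (rule Bochner_Integration.integrable_bound)
    show "integrable leb01 ?w"
      using w by (auto simp: has_bochner_integral_iff)
    show "AE x in leb01. norm (response_source x - s x) \<le> norm (?w x)"
      using bound by (intro AE_leb01I) force
    show "(\<lambda>x. response_source x - s x) \<in> borel_measurable leb01"
      using response_source_integral(1) by measurable
  qed
  from Bochner_Integration.integrable_diff[OF response_source_integral(1) this]
  have s: "integrable leb01 s"
    by simp
  have "L1_norm (\<lambda>x. response_source x - ulam_proj (2 ^ m) response_source x)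
      \<le> 2 * L1_norm (\<lambda>x. response_source x - s x)"
    by (rule ulam_proj_error_le[OF response_source_integral(1) step s])
  also have "L1_norm (\<lambda>x. response_source x - s x) \<le> (LINT x|leb01. ?w x)"
    using w bound by (intro L1_norm_le_integral) (auto simp: has_bochner_integral_iff)
  also have "(LINT x|leb01. ?w x) = 1 / 4 * ((1 + d) * ln (1 + d) - d * ln d)"
    using w by (simp add: has_bochner_integral_iff)
  also have "(1 + d) * ln (1 + d) \<le> 2 * d"
    using d ln_add_one_self_le_self[of d] by (intro mult_mono) auto
  also have "d * ln d = - (d * real m * ln 2)"
    by (simp add: d_def ln_div ln_realpow)
  also have "d * real m * ln 2 \<le> d * real m * (7 / 10)"
    using d ln2_le_25_over_36 by (intro mult_left_mono) auto
  finally show ?thesis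
    by (simp add: d_def field_simps)
qed

section \<open>The Neumann series and its approximation\<close>

text \<open>
  The sequence \<open>a\<close> is the solution of the form \<open>(\<beta> + \<alpha> * i) / 2 ^ i\<close> of
  \<open>a i - a (Suc i) = (1 + 7 / 20 * i) / 2 ^ i\<close>, that is, the sum of the bounds on the
  projection errors from level \<open>i\<close> on.
\<close>

lemma funpow_response_source_bound:
  defines "a \<equiv> \<lambda>i. (27 / 10 + 7 / 10 * real i) / 2 ^ i"
  shows "L1_norm ((doubling_transfer ^^ i) response_source) \<le> a i - a (Suc i)"
proof -
  have "a i - a (Suc i) = (1 + 7 / 20 * real i) / 2 ^ i"
    by (simp add: a_def field_simps)
  then show ?thesis
    using L1_norm_funpow_doubling_transfer_le[OF response_source_integral, of i]
      response_source_proj_error[of i] by linarith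
qed

lemma linear_response_exists: "\<exists>h. is_linear_response h"
  unfolding is_linear_response_def
proof (rule L1_sums_exists)
  show "integrable leb01 ((doubling_transfer ^^ i) response_source)" for i
    by (rule funpow_doubling_transfer(1)[OF response_source_integral(1)])
  let ?a = "\<lambda>i. (27 / 10 + 7 / 10 * real i) / 2 ^ i"
  have "?a \<longlonglongrightarrow> 0"
    by real_asymp
  then have "summable (\<lambda>i. ?a i - ?a (Suc i))"
    by (rule sums_summable[OF telescope_sums'])
  moreover have "norm (L1_norm ((doubling_transfer ^^ i) response_source)) \<le> ?a i - ?a (Suc i)" for i
    using funpow_response_source_bound[of i] L1_norm_nonneg by simp
  ultimately show "summable (\<lambda>i. L1_norm ((doubling_transfer ^^ i) response_source))"
    by (rule summable_comparison_test')
qed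

lemma h_appr_eq:
  assumes "x \<in> {0..<1}"
  shows "h_appr x = (\<Sum>i<20. (doubling_transfer ^^ i) (ulam_proj (2 ^ 20) response_source) x)"
proof -
  have "{0..19} = {..<20::nat}" by auto
  then show ?thesis
    unfolding h_appr_def using assms by (simp only: funpow_ulam_transfer)
qed

lemma integrable_h_appr: "integrable leb01 h_appr"
proof -
  have "integrable leb01 ((ulam_transfer (2 ^ 20) ^^ i) (ulam_proj (2 ^ 20) response_source))" for i
    by (cases i) (auto simp: ulam_transfer_def ulam_proj_integral)
  then show ?thesis
    unfolding h_appr_def by (intro Bochner_Integration.integrable_sum)
qed

theorem proposition6p5:
  "(\<exists>h. is_linear_response h) \<and>
   (\<forall>h. is_linear_response h \<longrightarrow>
        integrable leb01 h_appr \<and> L1_norm (\<lambda>x. h_appr x - h x) \<le> 0.00021)"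
proof (intro conjI allI impI)
  show "\<exists>h. is_linear_response h"
    by (rule linear_response_exists)
  show "integrable leb01 h_appr" by (rule integrable_h_appr)
  fix h assume h: "is_linear_response h"
  let ?g = response_source
  let ?P = "ulam_proj (2 ^ 20) ?g"
  let ?L = "\<lambda>i. doubling_transfer ^^ i"
  let ?r = "\<lambda>x. ?g x - ?P x"
  let ?a = "\<lambda>i. (27 / 10 + 7 / 10 * real i) / 2 ^ i :: real"
  have r: "integrable leb01 ?r"
    using response_source_integral(1) ulam_proj_integral(1)[of "2 ^ 20" ?g] by simp
  have Lr: "integrable leb01 (?L i ?r)" for i
    by (rule funpow_doubling_transfer(1)[OF r])
  have Lg: "integrable leb01 (?L i ?g)" for i
    by (rule funpow_doubling_transfer(1)[OF response_source_integral(1)])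
  have h_int: "integrable leb01 h"
    using h by (simp add: is_linear_response_def L1_sums_def)
  \<comment> \<open>The first summand is the discretisation error of the twenty terms that are kept, the second one
    is the truncation error of the Neumann series.\<close>
  have "L1_norm (\<lambda>x. h_appr x - h x)
      \<le> L1_norm (\<lambda>x. - (\<Sum>i<20. ?L i ?r x)) + L1_norm (\<lambda>x. (\<Sum>i<20. ?L i ?g x) - h x)"
  proof (rule L1_norm_triangle)
    fix x :: real assume "0 < x" "x < 1"
    then show "h_appr x - h x = - (\<Sum>i<20. ?L i ?r x) + ((\<Sum>i<20. ?L i ?g x) - h x)"
      by (simp add: h_appr_eq funpow_doubling_transfer_diff sum_subtractf)
  qed (use Lr Lg h_int in auto)
  also have "L1_norm (\<lambda>x. - (\<Sum>i<20. ?L i ?r x)) \<le> (\<Sum>i<20. L1_norm (?L i ?r))"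
    using L1_norm_sum_le[of "{..<20}" "\<lambda>i. ?L i ?r"] Lr by (simp add: L1_norm_def)
  also have "\<dots> \<le> (\<Sum>i<20::nat. L1_norm ?r)"
    by (intro sum_mono funpow_doubling_transfer(3)[OF r])
  \<comment> \<open>At level \<open>20\<close> the projection error is at most \<open>(1 + 7 / 20 * 20) / 2 ^ 20 = 8 / 2 ^ 20\<close>.\<close>
  also have "\<dots> \<le> 20 * (8 / 2 ^ 20)"
    using response_source_proj_error[of 20] by simp
  also have "L1_norm (\<lambda>x. (\<Sum>i<20. ?L i ?g x) - h x) \<le> ?a 20"
    by (rule L1_sums_tail_bound[of "\<lambda>i. ?L i ?g"])
      (use h funpow_response_source_bound in \<open>auto simp: is_linear_response_def\<close>)
  \<comment> \<open>The total is \<open>160 / 2 ^ 20 + 16.7 / 2 ^ 20\<close>, which is less than \<open>0.00017\<close>.\<close>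
  finally show "L1_norm (\<lambda>x. h_appr x - h x) \<le> 0.00021"
    by simp
qed

end
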